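(* Let $\mathbf{A}$ be any (possibly empty) composition of operators from $\{\mathbf{S},\mathbf{R}\}$. For every permutation $\theta$ sorted by $\mathbf{S}\circ\mathbf{A}$, the trees $\mathrm{T}_{\mathrm{in}}(\Phi_{\mathbf{A}}(\theta))$ and $\mathrm{T}_{\mathrm{in}}(\theta)$ have the same underlying unlabelled binary tree. That is, $\Phi_{\mathbf{A}}$ preserves the shape of the in-order tree.
   Context: Notation and conventions. - Permutations are in one-line notation, with composition $(\lambda\circ\sigma)(i)=\lambda(\sigma(i))$. - A sequence of distinct integers is identified with the permutation order-isomorphic to it. - $\mathrm{Av}(231)$ (resp. $\mathrm{Av}(132)$) is the set of permutations avoiding $231$ (resp. $132$). Operators. - $\mathbf{S}(\varepsilon)=\varepsilon$ and $\mathbf{S}(\alpha n\beta)=\mathbf{S}(\alpha)\mathbf{S}(\beta)n$, where $n$ is the maximum entry. - $\mathbf{R}$ is reversal. - $\theta$ is sorted by $\mathbf{S}\circ\mathbf{A}$ if $\mathbf{S}(\mathbf{A}(\theta))$ is the identity, equivalently $\mathbf{A}(\theta)\in\mathrm{Av}(231)$. The bijection $P$ and the map $\Phi_{\mathbf{A}}$. - $\alpha\oplus\beta=\alpha(\beta+|\alpha|)$ and $\alpha\ominus\beta=(\alpha+|\beta|)\beta$. - $P:\mathrm{Av}(231)\to\mathrm{Av}(132)$ is defined by $P(\varepsilon)=\varepsilon$ and $P(\alpha\oplus(1\ominus\beta))=(P(\alpha)\oplus1)\ominus P(\beta)$, using the unique decomposition of nonempty $231$-avoiders as $\alpha\oplus(1\ominus\beta)$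 with $\alpha,\beta\in\mathrm{Av}(231)$. - $\lambda_\pi$ is defined by $P(\pi)=\lambda_\pi\circ\pi$. - $\Phi_{\mathbf{A}}(\theta)=\lambda_{\mathbf{A}(\theta)}\circ\theta$. Trees. - A binary tree is decreasing if every child's label is smaller than its parent's. - The in-order reading is (left subtree reading)(root)(right subtree reading). - $\mathrm{T}_{\mathrm{in}}(\pi)$ is the unique decreasing binary tree with in-order reading $\pi$. *)

theory Defs
  imports "HOL-Library.Sublist" "HOL-Library.Tree"
begin

text \<open>Permutations are lists in one-line notation with entries \<open>1, \<dots>, n\<close>.\<close>

definition is_perm :: "nat list \<Rightarrow> bool" where
  "is_perm p \<longleftrightarrow> distinct p \<and> set p = {1..length p}"

definition id_perm :: "nat \<Rightarrow> nat list" where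
  "id_perm n = [1..<Suc n]"

text \<open>Entries are 1-based while list positions are 0-based, hence the shift of the index.\<close>

definition comp_perm :: "nat list \<Rightarrow> nat list \<Rightarrow> nat list" where
  "comp_perm l s = map (\<lambda>i. l ! (i - 1)) s"

definition order_iso :: "nat list \<Rightarrow> nat list \<Rightarrow> bool" where
  "order_iso xs ys \<longleftrightarrow> length xs = length ys \<and>
     (\<forall>i<length xs. \<forall>j<length xs. xs ! i < xs ! j \<longleftrightarrow> ys ! i < ys ! j)"

definition contains_pattern :: "nat list \<Rightarrow> nat list \<Rightarrow> bool" where
  "contains_pattern p q \<longleftrightarrow> (\<exists>xs. subseq xs p \<and> order_iso xs q)"

definition Av :: "nat list \<Rightarrow> nat list set" where
  "Av q = {p. is_perm p \<and> \<not> contains_pattern p q}"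

text \<open>The operator S: the words before and after the maximum entry need not be permutations of
  an initial segment, so it is defined on all lists.\<close>

function stack_sort :: "nat list \<Rightarrow> nat list" where
  "stack_sort xs = (if xs = [] then [] else
     (let n = Max (set xs) in
        stack_sort (takeWhile (\<lambda>x. x \<noteq> n) xs) @
        stack_sort (tl (dropWhile (\<lambda>x. x \<noteq> n) xs)) @ [n]))"
  by auto
termination
proof (relation "measure length", goal_cases)
  case 1
  show ?case by simp
next
  case (2 xs n)
  then have "n \<in> set xs" by simp
  then obtain a b where "xs = a @ n # b" "n \<notin> set a" by (meson split_list_first)
  then have "length (takeWhile (\<lambda>x. x \<noteq> n) xs) < length xs"
    by (auto simp: takeWhile_append)
  then show ?case by simp
next
  case (3 xs n)
  have "length (tl (dropWhile (\<lambda>x. x \<noteq> n) xs)) \<le> length xs - 1"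
    by (simp add: length_dropWhile_le diff_le_mono)
  with 3(1) show ?case by (cases xs) auto
qed

declare stack_sort.simps [simp del]

lemma stack_sort_Nil: "stack_sort [] = []"
  by (simp add: stack_sort.simps)

lemma stack_sort_max:
  assumes "\<forall>x \<in> set a \<union> set b. x < n"
  shows "stack_sort (a @ n # b) = stack_sort a @ stack_sort b @ [n]"
proof -
  have m: "Max (set (a @ n # b)) = n"
    using assms by (intro Max_eqI) (auto intro: less_imp_le)
  have t: "takeWhile (\<lambda>x. x \<noteq> n) (a @ n # b) = a"
    and d: "dropWhile (\<lambda>x. x \<noteq> n) (a @ n # b) = n # b"
    using assms by (auto simp: takeWhile_append dropWhile_append)
  show ?thesis
    by (subst stack_sort.simps) (simp only: m t d Let_def list.sel, simp)
qed

inductive SR_composition :: "(nat list \<Rightarrow> nat list) \<Rightarrow> bool" where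
  empty: "SR_composition id"
| S: "SR_composition A \<Longrightarrow> SR_composition (stack_sort \<circ> A)"
| R: "SR_composition A \<Longrightarrow> SR_composition (rev \<circ> A)"

definition direct_sum :: "nat list \<Rightarrow> nat list \<Rightarrow> nat list" where
  "direct_sum a b = a @ map (\<lambda>x. x + length a) b"

definition skew_sum :: "nat list \<Rightarrow> nat list \<Rightarrow> nat list" where
  "skew_sum a b = map (\<lambda>x. x + length b) a @ b"

inductive P_graph :: "nat list \<Rightarrow> nat list \<Rightarrow> bool" where
  empty: "P_graph [] []"
| sum: "a \<in> Av [2,3,1] \<Longrightarrow> b \<in> Av [2,3,1] \<Longrightarrow> P_graph a a' \<Longrightarrow> P_graph b b' \<Longrightarrow>
    P_graph (direct_sum a (skew_sum [1] b)) (skew_sum (direct_sum a' [1]) b')"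

definition bij_P :: "nat list \<Rightarrow> nat list" where
  "bij_P p = (THE q. P_graph p q)"

text \<open>\<open>P_graph\<close> is the graph of a function on the 231-avoiders
  (\<open>P_graph_ex1\<close> below), so the \<open>THE\<close> in \<open>bij_P\<close> is well defined there.\<close>

lemma sum_skew_sum: "direct_sum a (skew_sum [1] b) =
    a @ (length a + length b + 1) # map (\<lambda>x. x + length a) b"
  by (simp add: direct_sum_def skew_sum_def)

lemmas sum_skew_sum' = sum_skew_sum[unfolded One_nat_def]

lemma decomposition_unique:
  assumes "is_perm a" "is_perm b" "is_perm c" "is_perm d"
    and eq: "direct_sum a (skew_sum [1] b) = direct_sum c (skew_sum [1] d)"
  shows "a = c \<and> b = d"
proof -
  have len: "length a + length b = length c + length d"
    using arg_cong[OF eq, of length] by (simp add: sum_skew_sum')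
  let ?n = "length a + length b + 1"
  have "?n \<notin> set a" "?n \<notin> set c"
    "?n \<notin> set (map (\<lambda>x. x + length a) b)" "?n \<notin> set (map (\<lambda>x. x + length c) d)"
    using assms(1-4) len by (auto simp: is_perm_def)
  moreover have "a @ ?n # map (\<lambda>x. x + length a) b = c @ ?n # map (\<lambda>x. x + length c) d"
    using eq len by (simp add: sum_skew_sum')
  ultimately have ac: "a = c" and "map (\<lambda>x. x + length a) b = map (\<lambda>x. x + length c) d"
    by (metis append_Cons_eq_iff)+
  then have "b = d"
    by (metis (no_types, lifting) add_right_cancel inj_def inj_map_eq_map)
  with ac show ?thesis by simp
qed

lemma P_graph_functional: "P_graph p q \<Longrightarrow> P_graph p q' \<Longrightarrow> q = q'"
proof (induction arbitrary: q' rule: P_graph.induct)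
  case empty
  then show ?case by cases (auto simp: sum_skew_sum')
next
  case (sum a b a' b')
  from sum.prems show ?case
  proof cases
    case empty
    then show ?thesis by (simp add: sum_skew_sum')
  next
    case (sum c d c' d')
    have "a = c \<and> b = d"
      using sum \<open>a \<in> Av [2,3,1]\<close> \<open>b \<in> Av [2,3,1]\<close>
      by (intro decomposition_unique) (auto simp: Av_def)
    then show ?thesis using sum \<open>\<And>q'. P_graph a q' \<Longrightarrow> a' = q'\<close> \<open>\<And>q'. P_graph b q' \<Longrightarrow> b' = q'\<close>
      by auto
  qed
qed

lemma order_iso_231: "x < y \<Longrightarrow> z < x \<Longrightarrow> order_iso [x, y, z] [2, 3, 1]"
  unfolding order_iso_def by (auto simp: less_Suc_eq nth_Cons')

lemma decomposition_exists:
  assumes "p \<in> Av [2,3,1]" "p \<noteq> []"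
  obtains a b where "a \<in> Av [2,3,1]" "b \<in> Av [2,3,1]" "p = direct_sum a (skew_sum [1] b)"
proof -
  let ?n = "length p"
  have pp: "is_perm p" and av: "\<not> contains_pattern p [2,3,1]"
    using assms by (auto simp: Av_def)
  have "?n \<in> set p" using pp assms(2) by (auto simp: is_perm_def Suc_le_eq)
  then obtain a c where p: "p = a @ ?n # c" by (meson split_list)
  define m where "m = ?n"
  have p': "p = a @ m # c" using p m_def by simp
  have dist: "distinct (a @ m # c)" and sets: "set (a @ m # c) = {1..m}"
    using pp unfolding is_perm_def m_def[symmetric] unfolding p'[symmetric] by blast+
  have mlen: "m = length a + length c + 1"
    using arg_cong[OF p', of length] unfolding m_def[symmetric] by simp
  have lt: "x < y" if "x \<in> set a" "y \<in> set c" for x y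
  proof (rule ccontr)
    assume "\<not> x < y"
    have "x \<noteq> y" using dist that by auto
    with \<open>\<not> x < y\<close> have yx: "y < x" by simp
    have "x \<noteq> m" "x \<in> {1..m}" using that dist unfolding sets[symmetric] by auto
    then have xm: "x < m" by simp
    have "subseq [x] a" "subseq [y] c"
      using that by (auto simp: subseq_singleton_left)
    then have "subseq ([x] @ m # [y]) (a @ m # c)"
      by (intro list_emb_append_mono) auto
    then have "contains_pattern p [2,3,1]"
      using order_iso_231[OF xm yx] unfolding contains_pattern_def p' by auto
    with av show False by simp
  qed
  have un: "set a \<union> set c = {1..<m}"
  proof -
    have "set a \<union> set c = {1..m} - {m}" using dist unfolding sets[symmetric] by auto
    also have "\<dots> = {1..<m}" by auto
    finally show ?thesis .
  qed
  have cda: "card (set a) = length a" using dist by (simp add: distinct_card)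
  have "x \<le> length a" if x: "x \<in> set a" for x
  proof -
    have "{1..x} \<subseteq> set a"
    proof
      fix y assume y: "y \<in> {1..x}"
      have "x < m" using x un by auto
      then have "y \<in> set a \<union> set c" using y unfolding un by simp
      then show "y \<in> set a" using lt[OF x, of y] y by auto
    qed
    from card_mono[OF _ this] show ?thesis by (simp add: cda)
  qed
  then have "set a \<subseteq> {1..length a}" using un by auto
  then have seta: "set a = {1..length a}" by (intro card_subset_eq) (auto simp: cda)
  have setc: "set c = {length a + 1..length a + length c}"
  proof -
    have "set a \<inter> set c = {}" using dist by auto
    then have "set c = {1..<m} - {1..length a}" using un seta by blast
    also have "\<dots> = {length a + 1..length a + length c}" unfolding mlen by auto
    finally show ?thesis .
  qed
  define b where "b = map (\<lambda>x. x - length a) c"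
  have lb: "length b = length c" by (simp add: b_def)
  have cb: "c = map (\<lambda>x. x + length a) b"
    unfolding b_def map_map o_def by (rule map_idI[symmetric]) (auto simp: setc)
  have "set c = (\<lambda>x. x + length a) ` {1..length c}"
    unfolding setc by (simp add: image_add_atLeastAtMost' add.commute)
  moreover have "set c = (\<lambda>x. x + length a) ` set b" by (subst cb) simp
  moreover have "inj (\<lambda>x::nat. x + length a)" by (simp add: inj_def)
  ultimately have "set b = {1..length c}" by (metis inj_image_eq_iff)
  moreover have "distinct b" using dist cb by (metis distinct_append distinct.simps(2) distinct_map)
  ultimately have pb: "is_perm b" by (simp add: is_perm_def b_def)
  have pa: "is_perm a" using seta dist by (simp add: is_perm_def)
  have "\<not> contains_pattern a [2,3,1]"
    using av unfolding p' contains_pattern_def by (meson list_emb_append2 subseq_order.order_trans subseq_rev_drop_many)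
  moreover have "\<not> contains_pattern b [2,3,1]"
  proof
    assume "contains_pattern b [2,3,1]"
    then obtain ys where ys: "subseq ys b" "order_iso ys [2,3,1]"
      unfolding contains_pattern_def by blast
    then have "subseq (map (\<lambda>x. x + length a) ys) c" using cb subseq_map by metis
    then have "subseq (map (\<lambda>x. x + length a) ys) p"
      unfolding p' by (intro list_emb_append2 list_emb_Cons)
    moreover have "order_iso (map (\<lambda>x. x + length a) ys) [2,3,1]"
      using ys(2) unfolding order_iso_def by simp
    ultimately show False using av unfolding contains_pattern_def by blast
  qed
  ultimately have "a \<in> Av [2,3,1]" "b \<in> Av [2,3,1]" using pa pb by (auto simp: Av_def)
  moreover have "p = direct_sum a (skew_sum [1] b)"
    unfolding sum_skew_sum cb[symmetric] lb mlen[symmetric] by (rule p')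
  ultimately show thesis by (rule that)
qed

lemma P_graph_ex1: "p \<in> Av [2,3,1] \<Longrightarrow> \<exists>!q. P_graph p q"
proof (induction p rule: length_induct)
  case (1 p)
  show ?case
  proof (cases "p = []")
    case True
    then show ?thesis using P_graph.empty P_graph_functional by blast
  next
    case False
    then obtain a b where ab: "a \<in> Av [2,3,1]" "b \<in> Av [2,3,1]"
      and p: "p = direct_sum a (skew_sum [1] b)"
      using 1(2) decomposition_exists by blast
    then have "length a < length p" "length b < length p" by (simp_all add: sum_skew_sum')
    then obtain a' b' where "P_graph a a'" "P_graph b b'" using 1(1) ab by blast
    then show ?thesis unfolding p using P_graph.sum ab P_graph_functional by blast
  qed
qed

lemma bij_P_eqI: "P_graph p q \<Longrightarrow> bij_P p = q"
  unfolding bij_P_def using P_graph_functional by blast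

lemma bij_P_Nil: "bij_P [] = []"
  by (intro bij_P_eqI P_graph.empty)

lemma bij_P_sum:
  assumes "a \<in> Av [2,3,1]" "b \<in> Av [2,3,1]"
  shows "bij_P (direct_sum a (skew_sum [1] b)) = skew_sum (direct_sum (bij_P a) [1]) (bij_P b)"
  using P_graph.sum[OF assms] P_graph_ex1[OF assms(1)] P_graph_ex1[OF assms(2)] bij_P_eqI by metis

definition lam :: "nat list \<Rightarrow> nat list" where
  "lam p = (THE l. is_perm l \<and> length l = length p \<and> bij_P p = comp_perm l p)"

lemma length_direct_sum: "length (direct_sum a b) = length a + length b"
  by (simp add: direct_sum_def)

lemma length_skew_sum: "length (skew_sum a b) = length a + length b"
  by (simp add: skew_sum_def)

lemma shift_interval: "(\<lambda>x::nat. x + k) ` {1..n} = {k + 1..k + n}"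
  by (simp add: image_add_atLeastAtMost' add.commute)

lemma is_perm_direct_sum: "is_perm a \<Longrightarrow> is_perm b \<Longrightarrow> is_perm (direct_sum a b)"
  unfolding is_perm_def direct_sum_def
  by (auto simp: distinct_map inj_on_def shift_interval simp del: One_nat_def)

lemma is_perm_skew_sum: "is_perm a \<Longrightarrow> is_perm b \<Longrightarrow> is_perm (skew_sum a b)"
  unfolding is_perm_def skew_sum_def
  by (auto simp: distinct_map inj_on_def shift_interval simp del: One_nat_def)

lemma P_graph_perm: "P_graph p q \<Longrightarrow> is_perm q \<and> length q = length p"
proof (induction rule: P_graph.induct)
  case empty
  show ?case by (simp add: is_perm_def)
next
  case (sum a b a' b')
  have "is_perm [1]" by (simp add: is_perm_def)
  with sum show ?case
    by (simp add: is_perm_direct_sum is_perm_skew_sum length_direct_sum length_skew_sum)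
qed

text \<open>The \<open>THE\<close> in \<open>lam\<close> is well defined on the 231-avoiders.\<close>

lemma lam_ex1:
  assumes "p \<in> Av [2,3,1]"
  shows "\<exists>!l. is_perm l \<and> length l = length p \<and> bij_P p = comp_perm l p"
proof -
  define n where "n = length p"
  have p: "distinct p" "set p = {1..n}" using assms by (auto simp: Av_def is_perm_def n_def)
  obtain q where "P_graph p q" using P_graph_ex1[OF assms] by blast
  then have q: "distinct q" "set q = {1..n}" "length q = n" and Pp: "bij_P p = q"
    using P_graph_perm[of p q] bij_P_eqI by (auto simp: is_perm_def n_def)
  have inj: "inj_on (\<lambda>i. p ! i) {..<n}" using p(1) by (simp add: inj_on_nth n_def)
  have rng: "(\<lambda>i. p ! i) ` {..<n} = {1..n}"
    using p(2) by (auto simp: set_conv_nth n_def)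
  define l where "l = map (\<lambda>v. q ! the_inv_into {..<n} (\<lambda>i. p ! i) v) [1..<Suc n]"
  have l_nth: "l ! (p ! i - 1) = q ! i" if "i < n" for i
  proof -
    have "p ! i \<in> {1..n}" using that rng by blast
    then have "l ! (p ! i - 1) = q ! the_inv_into {..<n} (\<lambda>i. p ! i) (p ! i)"
      unfolding l_def by (subst nth_map) (auto simp del: upt_Suc)
    then show ?thesis using the_inv_into_f_f[OF inj] that by simp
  qed
  have len: "length l = n" by (simp add: l_def)
  have comp: "comp_perm l p = q"
    by (rule nth_equalityI) (auto simp: comp_perm_def q(3) n_def[symmetric] l_nth[simplified])
  have "set l = {1..n}"
  proof (rule card_seteq[symmetric])
    show "finite (set l)" by simp
    show "{1..n} \<subseteq> set l"
    proof
      fix v assume "v \<in> {1..n}"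
      then obtain i where i: "i < n" "v = q ! i" using q by (metis in_set_conv_nth)
      have "p ! i \<in> {1..n}" using i rng by blast
      then have "p ! i - 1 < length l" using len by auto
      then show "v \<in> set l" using l_nth[OF i(1)] i(2) by (metis nth_mem)
    qed
    show "card (set l) \<le> card {1..n}" using card_length[of l] len by simp
  qed
  then have "is_perm l" using len by (simp add: is_perm_def card_distinct)
  moreover have "l' = l" if l': "length l' = n" "comp_perm l' p = q" for l'
  proof (rule nth_equalityI)
    show "length l' = length l" using l' len by simp
    fix v assume "v < length l'"
    then have "Suc v \<in> {1..n}" using l' by auto
    then obtain i where i: "i < n" "Suc v = p ! i" using rng by (metis (no_types, lifting) imageE lessThan_iff)
    have "l' ! (p ! i - 1) = q ! i"
      using i(1) unfolding l'(2)[symmetric] comp_perm_def by (simp add: n_def)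
    then show "l' ! v = l ! v" using l_nth[OF i(1)] by (simp add: i(2)[symmetric])
  qed
  ultimately show ?thesis using len comp unfolding Pp n_def[symmetric] by metis
qed

definition Phi :: "(nat list \<Rightarrow> nat list) \<Rightarrow> nat list \<Rightarrow> nat list" where
  "Phi A t = comp_perm (lam (A t)) t"

fun decreasing :: "nat tree \<Rightarrow> bool" where
  "decreasing Leaf = True"
| "decreasing (Node l a r) =
     (decreasing l \<and> decreasing r \<and>
      (case l of Leaf \<Rightarrow> True | Node _ b _ \<Rightarrow> b < a) \<and>
      (case r of Leaf \<Rightarrow> True | Node _ b _ \<Rightarrow> b < a))"

definition T_in :: "nat list \<Rightarrow> nat tree" where
  "T_in p = (THE t. decreasing t \<and> inorder t = p)"

lemma decreasing_root: "decreasing (Node l a r) \<Longrightarrow> x \<in> set_tree l \<union> set_tree r \<Longrightarrow> x < a"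
proof -
  have root: "x \<le> value t" if "decreasing t" "x \<in> set_tree t" for t x
    using that
  proof (induction t)
    case Leaf
    then show ?case by simp
  next
    case (Node l a r)
    then consider "x = a" | "x \<in> set_tree l" | "x \<in> set_tree r" by auto
    then show ?case
    proof cases
      case 1
      then show ?thesis by simp
    next
      case 2
      with Node have "x \<le> value l" by simp
      with 2 Node.prems(1) show ?thesis by (cases l) simp_all
    next
      case 3
      with Node have "x \<le> value r" by simp
      with 3 Node.prems(1) show ?thesis by (cases r) simp_all
    qed
  qed
  assume "decreasing (Node l a r)" "x \<in> set_tree l \<union> set_tree r"
  then show "x < a"
    using root[of l x] root[of r x] by (cases l; cases r; force)
qed

lemma T_in_unique:
  "decreasing s \<Longrightarrow> decreasing t \<Longrightarrow> inorder s = inorder t \<Longrightarrow> s = t"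
proof (induction s arbitrary: t)
  case Leaf
  then show ?case by (cases t) auto
next
  case (Node l a r)
  from Node.prems(3) obtain l' a' r' where t: "t = Node l' a' r'" by (cases t) auto
  have 1: "\<forall>x \<in> set (inorder l) \<union> set (inorder r). x < a"
    using decreasing_root[OF Node.prems(1)] by simp
  have 2: "\<forall>x \<in> set (inorder l') \<union> set (inorder r'). x < a'"
    using decreasing_root Node.prems(2) t by (metis set_inorder)
  have eq: "inorder l @ a # inorder r = inorder l' @ a' # inorder r'"
    using Node.prems(3) t by simp
  have aa: "a = a'"
  proof (rule antisym)
    have "a \<in> set (inorder l' @ a' # inorder r')" unfolding eq[symmetric] by simp
    then show "a \<le> a'" using 2 by (auto intro: less_imp_le)
    have "a' \<in> set (inorder l @ a # inorder r)" unfolding eq by simp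
    then show "a' \<le> a" using 1 by (auto intro: less_imp_le)
  qed
  have "a \<notin> set (inorder l)" "a \<notin> set (inorder r)" "a \<notin> set (inorder l')" "a \<notin> set (inorder r')"
    using 1 2 aa by blast+
  with eq aa have "inorder l = inorder l'" "inorder r = inorder r'"
    by (metis append_Cons_eq_iff)+
  then show ?case using Node t aa by simp
qed

lemma T_in_exists: "distinct p \<Longrightarrow> \<exists>t. decreasing t \<and> inorder t = p"
proof (induction p rule: length_induct)
  case (1 p)
  show ?case
  proof (cases "p = []")
    case True
    then show ?thesis by (intro exI[of _ Leaf]) simp
  next
    case False
    then have "Max (set p) \<in> set p" by simp
    then obtain a b where p: "p = a @ Max (set p) # b" by (meson split_list)
    define m where "m = Max (set p)"
    have p': "p = a @ m # b" using p m_def by simp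
    have "\<forall>x\<in>set p. x \<le> m" using m_def by simp
    then have less: "\<forall>x\<in>set a \<union> set b. x < m" using 1(2) p' by (auto simp: le_less)
    obtain s t where st: "decreasing s" "inorder s = a" "decreasing t" "inorder t = b"
      using 1 p' by (metis add.commute distinct.simps(2) distinct_append length_append length_Cons
          less_Suc_eq_le le_add1 le_add2 add_Suc_right)
    have "decreasing (Node s m t) \<and> inorder (Node s m t) = p"
      using st less p' by (auto split: tree.split)
    then show ?thesis by blast
  qed
qed

lemma T_in_correct:
  assumes "is_perm p"
  shows "decreasing (T_in p)" "inorder (T_in p) = p"
proof -
  have "\<exists>!t. decreasing t \<and> inorder t = p"
    using T_in_exists T_in_unique assms unfolding is_perm_def by metis
  from theI'[OF this] show "decreasing (T_in p)" "inorder (T_in p) = p"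
    unfolding T_in_def by auto
qed

abbreviation shape :: "'a tree \<Rightarrow> unit tree" where
  "shape t \<equiv> map_tree (\<lambda>_. ()) t"

end

theory Submission
  imports Defs
begin

text \<open>Say that \<open>a\<close> dominates \<open>b\<close> in a word if \<open>a\<close> is the largest letter of some factor containing
  both. In a permutation this means that \<open>b\<close> is \<open>a\<close> or a descendant of \<open>a\<close> in the in-order tree.
  Both operators preserve domination: reversal obviously, and stack sorting because it turns the
  in-order reading of a decreasing tree into its post-order reading, in which every subtree is still
  a factor. On the other hand, relabelling a 231-avoider \<open>\<pi>\<close> by \<open>\<lambda>\<^sub>\<pi>\<close> only reverses the order of pairs
  of letters separated by a larger one, so it respects domination in \<open>\<pi> = A(\<theta>)\<close>, hence in
  \<open>\<theta>\<close>. Relabelling the tree of \<open>\<theta>\<close> by \<open>\<lambda>\<^sub>\<pi>\<close> therefore keeps it decreasing.\<close>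

definition dominates :: "'a::linorder list \<Rightarrow> 'a \<Rightarrow> 'a \<Rightarrow> bool" where
  "dominates p a b \<longleftrightarrow> (\<exists>w. sublist w p \<and> a \<in> set w \<and> b \<in> set w \<and> (\<forall>x\<in>set w. x \<le> a))"

lemma dominates_sublist: "dominates p a b \<Longrightarrow> sublist p q \<Longrightarrow> dominates q a b"
  unfolding dominates_def using sublist_order.order.trans by blast

lemma dominates_max:
  "a \<in> set p \<Longrightarrow> b \<in> set p \<Longrightarrow> \<forall>x\<in>set p. x \<le> a \<Longrightarrow> dominates p a b"
  unfolding dominates_def by blast

lemma dominates_rev: "dominates p a b \<Longrightarrow> dominates (rev p) a b"
  unfolding dominates_def by (metis set_rev sublist_rev)

text \<open>A factor through the maximum \<open>n\<close> can only be dominated by \<open>n\<close>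
  itself, and any other factor lies on one side of \<open>n\<close>. This case split drives the
  inductions on both the tree and \<open>P_graph\<close>.\<close>

lemma dominates_around_max:
  assumes "dominates (l @ n # r) a b" and "\<forall>x\<in>set l \<union> set r. x < n"
  obtains "a = n" "b \<in> set (l @ n # r)" | "dominates l a b" | "dominates r a b"
proof -
  obtain w where w: "sublist w (l @ n # r)" "a \<in> set w" "b \<in> set w" "\<forall>x\<in>set w. x \<le> a"
    using assms(1) unfolding dominates_def by blast
  have sub: "set w \<subseteq> set (l @ n # r)" using w(1) by (rule set_mono_sublist)
  show thesis
  proof (cases "n \<in> set w")
    case True
    then have "n \<le> a" using w(4) by blast
    moreover have "a \<le> n" using sub w(2) assms(2) by (auto intro: less_imp_le)
    ultimately show thesis using that(1) sub w(3) by auto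
  next
    case False
    have "sublist w l \<or> sublist w r"
    proof -
      obtain us vs where e: "l @ n # r = us @ w @ vs" using w(1) by (auto simp: sublist_def)
      then show ?thesis
        using False by (auto simp: append_eq_append_conv2 append_eq_Cons_conv Cons_eq_append_conv)
    qed
    then show thesis using that(2,3) w(2-4) unfolding dominates_def by blast
  qed
qed

text \<open>The root of a decreasing tree is the maximum of its in-order reading, so the recursion
  of \<open>stack_sort\<close> at the maximum is the recursion of \<open>postorder\<close> at the
  root.\<close>

lemma stack_sort_inorder: "decreasing t \<Longrightarrow> stack_sort (inorder t) = postorder t"
proof (induction t)
  case Leaf
  show ?case by (simp add: stack_sort_Nil)
next
  case (Node l a r)
  have "\<forall>x \<in> set (inorder l) \<union> set (inorder r). x < a"
    using decreasing_root[OF Node.prems] by simp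
  then show ?case using Node by (simp add: stack_sort_max)
qed

lemma dominates_postorder:
  "decreasing t \<Longrightarrow> dominates (inorder t) a b \<Longrightarrow> dominates (postorder t) a b"
proof (induction t)
  case Leaf
  then show ?case by simp
next
  case (Node l n r)
  have lt: "\<forall>x\<in>set (inorder l) \<union> set (inorder r). x < n"
    using decreasing_root[OF Node.prems(1)] by simp
  have dec: "decreasing l" "decreasing r" using Node.prems(1) by auto
  from Node.prems(2) have "dominates (inorder l @ n # inorder r) a b" by simp
  from this lt show ?case
  proof (cases rule: dominates_around_max)
    case 1
    with lt show ?thesis by (auto intro!: dominates_max intro: less_imp_le)
  next
    case 2
    show ?thesis by (rule dominates_sublist[OF Node.IH(1)[OF dec(1) 2]]) simp
  next
    case 3
    show ?thesis by (rule dominates_sublist[OF Node.IH(2)[OF dec(2) 3]]) simp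
  qed
qed

lemma dominates_stack_sort:
  assumes "distinct p" "dominates p a b"
  shows "dominates (stack_sort p) a b"
  using T_in_exists[OF assms(1)] assms(2) dominates_postorder stack_sort_inorder by metis

lemma is_perm_stack_sort:
  assumes "is_perm p"
  shows "is_perm (stack_sort p)" "length (stack_sort p) = length p"
proof -
  obtain t where t: "decreasing t" "inorder t = p"
    using T_in_exists assms unfolding is_perm_def by blast
  have S: "stack_sort p = postorder t" using stack_sort_inorder t by blast
  have len: "length (postorder t) = length p" and set: "set (postorder t) = set p"
    unfolding t(2)[symmetric] by simp_all
  \<comment> \<open>Distinctness survives because the post-order reading has the same letter set and
    the same length as \<open>p\<close>.\<close>
  have "card (set p) = length p" using assms by (simp add: is_perm_def distinct_card)
  then have "distinct (postorder t)" using len set by (metis card_distinct)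
  then show "is_perm (stack_sort p)" "length (stack_sort p) = length p"
    using assms len set S by (auto simp: is_perm_def)
qed

lemma SR_composition_is_perm:
  "SR_composition A \<Longrightarrow> is_perm p \<Longrightarrow> is_perm (A p) \<and> length (A p) = length p"
  by (induction rule: SR_composition.induct) (simp_all add: is_perm_stack_sort, simp add: is_perm_def)

lemma SR_composition_dominates:
  "SR_composition A \<Longrightarrow> is_perm p \<Longrightarrow> dominates p a b \<Longrightarrow> dominates (A p) a b"
proof (induction rule: SR_composition.induct)
  case (S A)
  then show ?case using SR_composition_is_perm dominates_stack_sort by (simp add: is_perm_def)
qed (simp_all add: dominates_rev)

text \<open>Post-order reads the left subtree before the right one, so sortedness puts every left
  letter weakly below every right letter. An occurrence of 231 must then lie inside a single
  subtree.\<close>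

lemma sorted_postorder_avoids_231:
  assumes "decreasing t" "sorted (postorder t)" "subseq [x, y, z] (inorder t)" "z < x" "x < y"
  shows False
  using assms
proof (induction t)
  case Leaf
  then show ?case by simp
next
  case (Node l n r)
  have lt: "u < n" if "u \<in> set_tree l \<union> set_tree r" for u
    using decreasing_root[OF Node.prems(1) that] .
  have cross: "u \<le> v" if "u \<in> set_tree l" "v \<in> set_tree r" for u v
    using Node.prems(2) that by (auto simp: sorted_append)
  have "subseq [x, y, z] (inorder l @ n # inorder r)" using Node.prems(3) by simp
  then obtain us vs where e: "[x, y, z] = us @ vs" "subseq us (inorder l)"
    "subseq vs (n # inorder r)" by (rule subseq_appendE)
  have us: "set us \<subseteq> set_tree l" using set_nths_subset e(2) unfolding subseq_conv_nths by fastforce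
  have vs: "set vs \<subseteq> insert n (set_tree r)"
    using set_nths_subset e(3) unfolding subseq_conv_nths by fastforce
  have "set us \<union> set vs = {x, y, z}" by (metis e(1) set_append list.set)
  then have "{x, y, z} \<subseteq> insert n (set_tree l \<union> set_tree r)" using us vs by blast
  then have le: "y \<le> n" using lt by (auto intro: less_imp_le)
  have "us \<noteq> []"
  proof
    assume "us = []"
    then have "subseq [x, y, z] (n # inorder r)" using e by simp
    \<comment> \<open>The occurrence cannot start at the root: \<open>x = n\<close> would give
      \<open>y \<le> x\<close>.\<close>
    then have "subseq [x, y, z] (inorder r)" using le Node.prems(5) by (auto split: if_splits)
    then show False using Node by (auto simp: sorted_append)
  qed
  moreover have "vs \<noteq> []"
  proof
    assume "vs = []"
    then have "subseq [x, y, z] (inorder l)" using e by simp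
    then show False using Node by (auto simp: sorted_append)
  qed
  ultimately have "x \<in> set us" "z \<in> set vs"
    using e(1) by (auto simp: Cons_eq_append_conv)
  \<comment> \<open>Here \<open>z\<close> is not the root, since
    \<open>z < x < y \<le> n\<close>.\<close>
  then have "x \<in> set_tree l" "z \<in> set_tree r" using us vs le Node.prems(4,5) by auto
  then show False using cross Node.prems(4) by force
qed

lemma order_iso_231D:
  assumes "order_iso xs [2,3,1]"
  obtains x y z where "xs = [x, y, z]" "z < x" "x < y"
proof -
  have "length xs = Suc (Suc (Suc 0))" using assms by (simp add: order_iso_def)
  then obtain x y z where xs: "xs = [x, y, z]" by (auto simp: length_Suc_conv)
  have iff: "xs ! i < xs ! j \<longleftrightarrow> [2, 3, 1::nat] ! i < [2, 3, 1] ! j" if "i < 3" "j < 3" for i j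
    using assms that xs by (simp add: order_iso_def)
  have "z < x" "x < y" using iff[of 2 0] iff[of 0 1] xs by simp_all
  with xs show thesis by (rule that)
qed

text \<open>This places \<open>A \<theta>\<close> in the domain where \<open>bij_P\<close> and
  \<open>lam\<close> are well defined.\<close>

lemma stack_sortable_avoids_231:
  assumes "is_perm p" "sorted (stack_sort p)"
  shows "p \<in> Av [2,3,1]"
proof -
  obtain t where t: "decreasing t" "inorder t = p"
    using T_in_exists assms unfolding is_perm_def by blast
  have "sorted (postorder t)" using assms(2) stack_sort_inorder t by metis
  then have "\<not> contains_pattern p [2,3,1]"
    unfolding contains_pattern_def
    using sorted_postorder_avoids_231[OF t(1)] t(2) by (metis order_iso_231D)
  then show ?thesis using assms(1) by (simp add: Av_def)
qed

text \<open>The map \<open>P\<close> fixes the maximum and exchanges the value ranges of the two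
  blocks around it; letters of different blocks never dominate each other. The relabelling
  \<open>f\<close> is an arbitrary function so that the induction hypotheses apply to shifted
  versions of it.\<close>

lemma P_graph_dominates:
  assumes "P_graph p q" "is_perm p" "q = map f p" "dominates p a b"
  shows "f b \<le> f a"
  using assms
proof (induction arbitrary: f a b rule: P_graph.induct)
  case empty
  then show ?case by (simp add: dominates_def)
next
  case (sum l r l' r')
  define k where "k = length l"
  define m where "m = length r"
  define n where "n = k + m + 1"
  have pl: "is_perm l" "is_perm r" using sum.hyps by (auto simp: Av_def)
  have ql: "is_perm l'" "is_perm r'" "length l' = k" "length r' = m"
    using P_graph_perm sum.hyps k_def m_def n_def by auto
  have dec: "direct_sum l (skew_sum [1] r) = l @ n # map (\<lambda>x. x + k) r"
    by (simp add: sum_skew_sum' k_def m_def n_def)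
  \<comment> \<open>Both words carry \<open>n\<close> at position \<open>k\<close>, hence
    \<open>f n = n\<close>.\<close>
  have "skew_sum (direct_sum l' [1]) r' = map (\<lambda>x. x + m) l' @ n # r'"
    using ql(3,4) by (simp add: skew_sum_def direct_sum_def n_def)
  then have f: "map (\<lambda>x. x + m) l' @ n # r' = map f (l @ n # map (\<lambda>x. x + k) r)"
    using sum.prems(2) unfolding dec by simp
  then have fl: "map (\<lambda>x. x + m) l' = map f l" and fn: "f n = n"
    and fr: "r' = map (f \<circ> (\<lambda>x. x + k)) r"
    using ql(3) by (simp_all add: k_def eq_commute[of n])
  have dom: "dominates (l @ n # map (\<lambda>x. x + k) r) a b"
    using sum.prems(3) unfolding dec .
  have lt: "\<forall>x\<in>set l \<union> set (map (\<lambda>x. x + k) r). x < n"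
    using pl by (auto simp: is_perm_def k_def m_def n_def)
  from dom lt show ?case
  proof (cases rule: dominates_around_max)
    case 1
    have "f b \<in> set (map (\<lambda>x. x + m) l' @ n # r')" unfolding f set_map using 1(2) by (rule imageI)
    then have "f b \<le> n" using ql by (auto simp: is_perm_def k_def m_def n_def)
    then show ?thesis using 1(1) fn by simp
  next
    case 2
    \<comment> \<open>The left block of the image is \<open>l'\<close> raised by \<open>m\<close>,
      so the induction hypothesis is used for \<open>f x - m\<close>. The bound
      \<open>m \<le> f a\<close> below makes the truncated subtraction harmless.\<close>
    have "l' = map (\<lambda>x. x - m) (map (\<lambda>x. x + m) l')" by (simp add: o_def)
    also have "\<dots> = map (\<lambda>x. f x - m) l" unfolding fl by simp
    finally have "f b - m \<le> f a - m" using sum.IH(1)[OF pl(1) _ 2] by blast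
    moreover have "f a \<in> set (map (\<lambda>x. x + m) l')"
      unfolding fl using 2 set_mono_sublist unfolding dominates_def by fastforce
    then have "m \<le> f a" by auto
    ultimately show ?thesis by linarith
  next
    case 3
    \<comment> \<open>The right block is \<open>r\<close> raised by \<open>k\<close>, so the
      dominating factor is shifted back into \<open>r\<close>.\<close>
    then obtain w where w: "sublist w (map (\<lambda>x. x + k) r)" "a \<in> set w" "b \<in> set w"
      "\<forall>x\<in>set w. x \<le> a" unfolding dominates_def by blast
    then obtain v where v: "w = map (\<lambda>x. x + k) v" "sublist v r"
      by (auto simp: sublist_def map_eq_append_conv append_eq_map_conv)
    then obtain a0 b0 where ab: "a = a0 + k" "b = b0 + k" "a0 \<in> set v" "b0 \<in> set v"
      using w by auto
    then have "dominates r a0 b0" unfolding dominates_def using v w(4) by auto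
    from sum.IH(2)[OF pl(2) fr this] show ?thesis using ab by simp
  qed
qed

text \<open>Each node dominates its whole subtree, so \<open>f\<close> keeps it weakly above its
  descendants; injectivity makes this strict.\<close>

lemma decreasing_map_tree:
  assumes "decreasing t" "inj_on f (set_tree t)"
    and "\<And>a b. dominates (inorder t) a b \<Longrightarrow> f b \<le> f a"
  shows "decreasing (map_tree f t)"
  using assms
proof (induction t)
  case Leaf
  show ?case by simp
next
  case (Node l n r)
  have below: "f x < f n" if x: "x \<in> set_tree l \<union> set_tree r" for x
  proof -
    have "dominates (inorder \<langle>l, n, r\<rangle>) n x"
      using x decreasing_root[OF Node.prems(1)] by (intro dominates_max) (auto intro: less_imp_le)
    then have "f x \<le> f n" by (rule Node.prems(3))
    moreover have "f x \<noteq> f n"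
      using x inj_onD[OF Node.prems(2), of x n] decreasing_root[OF Node.prems(1) x] by auto
    ultimately show ?thesis by simp
  qed
  have "sublist (inorder l) (inorder \<langle>l, n, r\<rangle>)" by simp
  moreover have "sublist (inorder r) (inorder \<langle>l, n, r\<rangle>)"
    using sublist_appendI[of "inorder r" "inorder l @ [n]" "[]"] by simp
  ultimately have "f b \<le> f a" if "dominates (inorder l) a b \<or> dominates (inorder r) a b" for a b
    using that dominates_sublist Node.prems(3) by blast
  then have "decreasing (map_tree f l)" "decreasing (map_tree f r)"
    using Node.IH Node.prems(1,2) by (auto simp: inj_on_Un)
  then show ?case using below by (cases l; cases r) simp_all
qed

theorem theorem4p10:
  fixes A :: "nat list \<Rightarrow> nat list" and \<theta> :: "nat list"
  assumes "SR_composition A"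
    and "is_perm \<theta>"
    and "stack_sort (A \<theta>) = id_perm (length \<theta>)"
  shows "shape (T_in (Phi A \<theta>)) = shape (T_in \<theta>)"
proof -
  \<comment> \<open>This is \<open>lam (A \<theta>)\<close> as a function on letters, so
    \<open>Phi A \<theta>\<close> is \<open>map f \<theta>\<close>.\<close>
  define f where "f i = lam (A \<theta>) ! (i - 1)" for i
  have A: "is_perm (A \<theta>)" "length (A \<theta>) = length \<theta>"
    using SR_composition_is_perm assms(1,2) by auto
  then have av: "A \<theta> \<in> Av [2,3,1]"
    by (intro stack_sortable_avoids_231) (simp_all add: assms(3) id_perm_def del: upt_Suc)
  then obtain q where q: "P_graph (A \<theta>) q" using P_graph_ex1 by blast
  have qf: "q = map f (A \<theta>)"
    using theI'[OF lam_ex1[OF av]] bij_P_eqI[OF q]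
    unfolding lam_def[symmetric] by (simp add: comp_perm_def f_def[abs_def])
  have "set (A \<theta>) = set \<theta>" using A assms(2) by (simp add: is_perm_def)
  \<comment> \<open>The word \<open>q\<close> is a permutation, and distinctness of
    \<open>map f (A \<theta>)\<close> is injectivity of \<open>f\<close> on the letters.\<close>
  then have inj: "inj_on f (set \<theta>)"
    using P_graph_perm[OF q] qf by (simp add: is_perm_def distinct_map)
  have mono: "f b \<le> f a" if "dominates \<theta> a b" for a b
    using P_graph_dominates[OF q A(1) qf] SR_composition_dominates[OF assms(1,2) that] .
  have T: "decreasing (T_in \<theta>)" "inorder (T_in \<theta>) = \<theta>" using T_in_correct assms(2) by auto
  then have "decreasing (map_tree f (T_in \<theta>))"
    using inj mono by (intro decreasing_map_tree) (simp_all flip: set_inorder)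
  moreover have "inorder (map_tree f (T_in \<theta>)) = Phi A \<theta>"
    using T(2) by (simp add: inorder_map Phi_def comp_perm_def f_def[abs_def])
  \<comment> \<open>Uniqueness of the decreasing tree identifies the relabelled tree, and
    relabelling does not change the shape.\<close>
  ultimately have "T_in (Phi A \<theta>) = map_tree f (T_in \<theta>)"
    unfolding T_in_def[of "Phi A \<theta>"] by (intro the_equality) (auto intro: T_in_unique)
  then show ?thesis by (simp add: tree.map_comp o_def)
qed

end
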